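(* Let $L$ be a semimodular lattice of finite length, let $e$ be a join-irreducible element of $L$ that is not an atom of $L$, let $e_\ast$ denote the unique lower cover of $e$ in $L$, and let $h\in L$ with $h<e_\ast$. Then the structure $K:=L(e_\ast\!\searrow h)=(L\cup N,\leq_K)$ is an extension of $L$ that lowers $e$ to a cover of $h$ (in particular, it is a lattice).
   Context: For a lattice $M$ of finite length, $J(M)$ denotes the set of (nonzero) join-irreducible elements of $M$, i.e. those having exactly one lower cover in $M$. A lattice is semimodular if $a\wedge b\prec a$ implies $b\prec a\vee b$. The length of a chain $C$ is $|C|-1$; the length of a poset is the supremum of the lengths of its chains. $x\prec_L y$ means that $y$ covers $x$ in $L$, and $x\preceq_L y$ means $x\prec_L y$ or $x=y$. Construction of $L(e_\ast\!\searrow h)$. Let $$D:=\{x\in L: h\leq x \text{ and } (\forall y\in L)\,(x\preceq_L y\Rightarrow e\not\leq y)\}.$$ Let $N:=\{x^{\blacktriangle}: x\in D\}$ be a set disjoint from $L$, where $x\mapsto x^{\blacktriangle}$ is a bijection $D\to N$; for $y=x^{\blacktriangle}\in N$ write $y^{\triangledown}:=x$. Let $K:=L\cup N$ and define $x\leq_K y$ to hold iff one of the following holds: (1) $x,y\in L$ and $x\leq_L y$; (2) $x,y\in N$ and $x^{\triangledown}\leq_L y^{\triangledown}$; (3) $x\in L$, $y\in N$ and $x\leq_L y^{\triangledown}$; (4) $x\in N$, $y\in L$ and $x^{\triangledown}\vee_L e\leq_L y$. Then $L(e_\ast\!\searrow h):=(K,\leq_K)$. Definition of lowering. A lattice $K$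 is "an extension of $L$ that lowers $e$ to a cover of $h$" if: (i) $K$ is a semimodular lattice of finite length, $L$ is a sublattice of $K$, and $\mathrm{length}(K)=\mathrm{length}(L)$; (ii) $J(L)\setminus J(K)=\{e\}$ and $J(K)\setminus J(L)=\{e'\}$ for a unique element $e'\in J(K)$; (iii) the unique lower cover of $e'$ in $K$ is $h$, and $h\in L$ and $h<e_\ast$. *)

theory Defs
  imports "HOL-Algebra.Lattice" "HOL-Library.Extended_Nat"
begin

definition covers :: "'a gorder \<Rightarrow> 'a \<Rightarrow> 'a \<Rightarrow> bool" where
  "covers M x y \<longleftrightarrow> x \<in> carrier M \<and> y \<in> carrier M \<and> x \<sqsubset>\<^bsub>M\<^esub> y \<and>
     \<not> (\<exists>z \<in> carrier M. x \<sqsubset>\<^bsub>M\<^esub> z \<and> z \<sqsubset>\<^bsub>M\<^esub> y)"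
  \<comment> \<open>argument order follows the infix notation: \<open>covers M x y\<close> is \<open>x \<prec> y\<close>, i.e. \<open>y\<close> covers \<open>x\<close>\<close>

definition covers_eq :: "'a gorder \<Rightarrow> 'a \<Rightarrow> 'a \<Rightarrow> bool" where
  "covers_eq M x y \<longleftrightarrow> covers M x y \<or> x = y"

definition atom :: "'a gorder \<Rightarrow> 'a \<Rightarrow> bool" where
  "atom M a \<longleftrightarrow> (\<exists>z. least M z (carrier M) \<and> covers M z a)"

definition semimodular :: "'a gorder \<Rightarrow> bool" where
  "semimodular M \<longleftrightarrow> (\<forall>a \<in> carrier M. \<forall>b \<in> carrier M.
     covers M (a \<sqinter>\<^bsub>M\<^esub> b) a \<longrightarrow> covers M b (a \<squnion>\<^bsub>M\<^esub> b))"

text \<open>The bottom element has no lower cover, so it is excluded automatically.\<close>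

definition join_irreducibles :: "'a gorder \<Rightarrow> 'a set" where
  "join_irreducibles M = {x \<in> carrier M. \<exists>!y. covers M y x}"

definition lower_cover :: "'a gorder \<Rightarrow> 'a \<Rightarrow> 'a" where
  "lower_cover M x = (THE y. covers M y x)"
  \<comment> \<open>meaningful only for \<open>x \<in> join_irreducibles M\<close>; this is \<open>x\<^sub>*\<close>\<close>

definition order_chain :: "'a gorder \<Rightarrow> 'a set \<Rightarrow> bool" where
  "order_chain M C \<longleftrightarrow> C \<subseteq> carrier M \<and> C \<noteq> {} \<and>
     (\<forall>x \<in> C. \<forall>y \<in> C. x \<sqsubseteq>\<^bsub>M\<^esub> y \<or> y \<sqsubseteq>\<^bsub>M\<^esub> x)"

definition chain_length :: "'a set \<Rightarrow> enat" where
  "chain_length C = (if finite C then enat (card C - 1) else \<infinity>)"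

definition order_length :: "'a gorder \<Rightarrow> enat" where
  "order_length M = (SUP C \<in> {C. order_chain M C}. chain_length C)"

definition sublattice :: "'a gorder \<Rightarrow> 'a gorder \<Rightarrow> bool" where
  "sublattice L K \<longleftrightarrow> carrier L \<noteq> {} \<and> carrier L \<subseteq> carrier K \<and>
     (\<forall>x \<in> carrier L. \<forall>y \<in> carrier L.
        (x \<sqsubseteq>\<^bsub>L\<^esub> y \<longleftrightarrow> x \<sqsubseteq>\<^bsub>K\<^esub> y) \<and> x \<squnion>\<^bsub>K\<^esub> y \<in> carrier L \<and> x \<sqinter>\<^bsub>K\<^esub> y \<in> carrier L)"

definition semimodular_lattice_fin_length :: "'a gorder \<Rightarrow> bool" where
  "semimodular_lattice_fin_length M \<longleftrightarrow> lattice M \<and> semimodular M \<and> order_length M < \<infinity>"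

definition lowering_dom :: "'a gorder \<Rightarrow> 'a \<Rightarrow> 'a \<Rightarrow> 'a set" where
  "lowering_dom L e h = {x \<in> carrier L. h \<sqsubseteq>\<^bsub>L\<^esub> x \<and>
     (\<forall>y \<in> carrier L. covers_eq L x y \<longrightarrow> \<not> e \<sqsubseteq>\<^bsub>L\<^esub> y)}"

text \<open>
  The lattice \<open>L(e\<^sub>* \<searrow> h)\<close>. The map \<open>up\<close> is the bijection from \<open>D = lowering_dom L e h\<close> onto the
  set \<open>N\<close> of new elements, and \<open>dn\<close> is its inverse. The definition is meaningful when \<open>up\<close> is
  injective on \<open>D\<close> and \<open>up ` D\<close> is disjoint from \<open>carrier L\<close>.
\<close>

definition lowering :: "'a gorder \<Rightarrow> 'a \<Rightarrow> 'a \<Rightarrow> ('a \<Rightarrow> 'a) \<Rightarrow> 'a gorder" where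
  "lowering L e h up =
    (let D = lowering_dom L e h; N = up ` D; dn = inv_into D up in
     \<lparr> carrier = carrier L \<union> N,
       eq = (=),
       le = (\<lambda>x y.
         (x \<in> carrier L \<and> y \<in> carrier L \<and> x \<sqsubseteq>\<^bsub>L\<^esub> y) \<or>
         (x \<in> N \<and> y \<in> N \<and> dn x \<sqsubseteq>\<^bsub>L\<^esub> dn y) \<or>
         (x \<in> carrier L \<and> y \<in> N \<and> x \<sqsubseteq>\<^bsub>L\<^esub> dn y) \<or>
         (x \<in> N \<and> y \<in> carrier L \<and> dn x \<squnion>\<^bsub>L\<^esub> e \<sqsubseteq>\<^bsub>L\<^esub> y)) \<rparr>)"

definition lowers_to_cover :: "'a gorder \<Rightarrow> 'a gorder \<Rightarrow> 'a \<Rightarrow> 'a \<Rightarrow> bool" where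
  "lowers_to_cover K L e h \<longleftrightarrow>
     semimodular_lattice_fin_length K \<and> sublattice L K \<and> order_length K = order_length L \<and>
     join_irreducibles L - join_irreducibles K = {e} \<and>
     (\<exists>!e'. e' \<in> join_irreducibles K \<and>
        join_irreducibles K - join_irreducibles L = {e'} \<and> lower_cover K e' = h) \<and>
     h \<in> carrier L \<and> h \<sqsubset>\<^bsub>L\<^esub> lower_cover L e"

end

theory Submission
  imports Defs
begin

text \<open>
  Write \<open>K\<close> for \<open>L(e\<^sub>* \<searrow> h)\<close> and \<open>x\<^sup>+\<close> for the new element above \<open>x \<in> D\<close>. In \<open>L\<close>, the set \<open>D\<close>
  consists of the \<open>x \<ge> h\<close> for which \<open>x < x \<squnion> e\<close> holds but is not a cover; so there is room for
  \<open>x\<^sup>+\<close> between \<open>x\<close> and \<open>x \<squnion> e\<close>. By semimodularity \<open>D\<close> is a down-set of the filter above \<open>h\<close>: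
  if \<open>z \<le> x\<close>, then a cover \<open>z \<prec> z \<squnion> e\<close> would be pushed up to a cover \<open>x \<prec> x \<squnion> e\<close>.

  For \<open>u \<ge> h\<close> let \<open>adjoin u\<close> be \<open>u\<^sup>+\<close> if \<open>u \<in> D\<close> and \<open>u \<squnion> e\<close> otherwise. This is the join of \<open>u\<close>
  and \<open>h\<^sup>+\<close> in \<open>K\<close>, and a join in \<open>K\<close> with at least one new argument is \<open>adjoin\<close> applied to the
  join in \<open>L\<close> of the underlying elements. The meet of \<open>p\<close> and \<open>q\<close> in \<open>K\<close> is the meet of the
  underlying elements or, if \<open>p\<close> and \<open>q\<close> are each new or above \<open>e\<close> and not both old, the new
  element above it. Thus \<open>K\<close> is a lattice, and old elements keep their joins and meets.

  For the length, note that no old element lies between two new ones. A chain of \<open>K\<close> therefore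
  has a block of new elements; dropping the superscript \<open>+\<close> identifies at most one of them with
  an old element of the chain, and this loss is made up for by an element strictly between \<open>b\<close>
  and \<open>b \<squnion> e\<close>, where \<open>b\<^sup>+\<close> is the top of the block (\<open>order_chain_in_K_bounded\<close>).

  Semimodularity is proved in the form that \<open>p \<prec> q\<close> implies \<open>p \<squnion> r \<preceq> q \<squnion> r\<close>. The covers of \<open>K\<close> are
  the covers of \<open>L\<close>, the pairs \<open>x \<prec> x\<^sup>+\<close>, the pairs \<open>x\<^sup>+ \<prec> y\<^sup>+\<close> with \<open>x \<prec> y\<close>, and
  those \<open>x\<^sup>+ \<prec> x \<squnion> e\<close> for which no element of \<open>D\<close> lies in \<open>L\<close> strictly between \<open>x\<close> and \<open>x \<squnion> e\<close>.
  The decisive cases (\<open>adjoin_covers_eq\<close> and \<open>adjoin_covers_eq_join_e\<close>) come down to the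
  Jordan-Hoelder property for intervals of length two (\<open>interval_of_length_two\<close>).

  Finally, the description of covers determines the join-irreducible elements. The element \<open>h\<^sup>+\<close>
  is the only new one, because \<open>x\<^sup>+\<close> with \<open>x > h\<close> covers both \<open>x\<close> and some \<open>y\<^sup>+\<close>; and \<open>e\<close> is lost
  because \<open>h\<^sup>+ < e\<close> lies below a lower cover of \<open>e\<close> different from \<open>e\<^sub>*\<close>.
\<close>

section \<open>Covers and chains in partially ordered sets of finite length\<close>

locale finite_length_order = partial_order L for L :: "'a gorder" (structure) +
  assumes finite_length: "order_length L < \<infinity>"
begin

lemma covers_iff:
  "covers L x y \<longleftrightarrow> x \<in> carrier L \<and> y \<in> carrier L \<and> x \<sqsubseteq> y \<and> x \<noteq> y \<and>
    (\<forall>z\<in>carrier L. x \<sqsubseteq> z \<longrightarrow> z \<sqsubseteq> y \<longrightarrow> z = x \<or> z = y)"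
  unfolding covers_def lless_eq by blast

lemma covers_between:
  "\<lbrakk>covers L x y; z \<in> carrier L; x \<sqsubseteq> z; z \<sqsubseteq> y\<rbrakk> \<Longrightarrow> z = x \<or> z = y"
  by (simp add: covers_iff)

lemma order_chain_bounded:
  "\<exists>n. \<forall>C. order_chain L C \<longrightarrow> finite C \<and> card C \<le> n"
proof -
  obtain m where m: "order_length L = enat m"
    using finite_length by (cases "order_length L") auto
  have "finite C \<and> card C \<le> Suc m" if "order_chain L C" for C
  proof -
    have "chain_length C \<le> enat m"
      unfolding m[symmetric] order_length_def by (rule SUP_upper) (simp add: that)
    then show ?thesis by (auto simp: chain_length_def split: if_splits)
  qed
  then show ?thesis by blast
qed

lemma order_chain_has_greatest:
  assumes "order_chain L C"
  obtains m where "m \<in> C" "\<And>x. x \<in> C \<Longrightarrow> x \<sqsubseteq> m"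
proof -
  have C: "C \<subseteq> carrier L" "C \<noteq> {}" "\<And>x y. x \<in> C \<Longrightarrow> y \<in> C \<Longrightarrow> x \<sqsubseteq> y \<or> y \<sqsubseteq> x"
    using assms by (auto simp: order_chain_def)
  obtain n where "\<And>C. order_chain L C \<Longrightarrow> finite C \<and> card C \<le> n"
    using order_chain_bounded by blast
  then have "finite C" using assms by blast
  moreover have "transp_on C (\<sqsubset>)"
    by (rule transp_onI, rule lless_trans) (use C(1) in auto)
  moreover have "asymp_on C (\<sqsubset>)"
    by (rule asymp_onI, rule notI, rule lless_antisym) (use C(1) in auto)
  ultimately obtain m where m: "m \<in> C" "\<forall>x\<in>C. x \<noteq> m \<longrightarrow> \<not> m \<sqsubset> x"
    using Finite_Set.bex_max_element[of C "(\<sqsubset>)"] C(2) by blast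
  have "x \<sqsubseteq> m" if x: "x \<in> C" for x
  proof (cases "x = m")
    case False
    then have "\<not> m \<sqsubseteq> x" using m x by (simp add: lless_eq)
    then show ?thesis using C(3)[OF x m(1)] by blast
  qed (use x C(1) in auto)
  then show thesis using that m(1) by blast
qed

text \<open>A chain of maximal size in the half-open interval from \<open>a\<close> to \<open>b\<close> must end in a lower cover
  of \<open>b\<close>, since anything between its top and \<open>b\<close> could be added.\<close>

lemma lower_cover_above:
  assumes "a \<in> carrier L" "b \<in> carrier L" "a \<sqsubseteq> b" "a \<noteq> b"
  obtains c where "a \<sqsubseteq> c" "covers L c b"
proof -
  let ?P = "\<lambda>C. order_chain L C \<and> (\<forall>x\<in>C. a \<sqsubseteq> x \<and> x \<sqsubseteq> b \<and> x \<noteq> b)"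
  obtain n where n: "\<And>C. order_chain L C \<Longrightarrow> finite C \<and> card C \<le> n"
    using order_chain_bounded by blast
  have "?P {a}" using assms by (auto simp: order_chain_def)
  moreover have "\<forall>C. ?P C \<longrightarrow> card C < Suc n" using n by (simp add: less_Suc_eq_le)
  ultimately have "\<exists>C. ?P C \<and> (\<forall>C'. ?P C' \<longrightarrow> card C' \<le> card C)"
    by (rule ex_has_greatest_nat[of ?P "{a}" card "Suc n"])
  then obtain C where C: "?P C" and max: "\<And>C'. ?P C' \<Longrightarrow> card C' \<le> card C"
    by (elim exE conjE) simp
  obtain m where m: "m \<in> C" "\<And>x. x \<in> C \<Longrightarrow> x \<sqsubseteq> m"
    using order_chain_has_greatest[OF conjunct1[OF C]] by auto
  have CL: "C \<subseteq> carrier L" using C by (simp add: order_chain_def)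
  have "z = m \<or> z = b" if z: "z \<in> carrier L" "m \<sqsubseteq> z" "z \<sqsubseteq> b" for z
  proof (rule ccontr)
    assume neq: "\<not> (z = m \<or> z = b)"
    have below: "x \<sqsubseteq> z" if "x \<in> C" for x
      using that m CL z le_trans[of x m z] by blast
    have "?P (insert z C)"
      using C below z neq m CL assms le_trans[of a m z] by (auto simp: order_chain_def)
    moreover have "z \<notin> C" using m z neq CL by (metis le_antisym subsetD)
    ultimately show False using max[of "insert z C"] n C by auto
  qed
  then have "covers L m b" using m CL C assms by (auto simp: covers_iff)
  then show thesis using that m C by blast
qed

end

section \<open>Semimodular lattices\<close>

context lattice
begin

lemma join_le_iff:
  "\<lbrakk>x \<in> carrier L; y \<in> carrier L; z \<in> carrier L\<rbrakk> \<Longrightarrow> x \<squnion> y \<sqsubseteq> z \<longleftrightarrow> x \<sqsubseteq> z \<and> y \<sqsubseteq> z"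
  by (meson join_closed join_le join_left join_right le_trans)

lemma le_meet_iff:
  "\<lbrakk>x \<in> carrier L; y \<in> carrier L; z \<in> carrier L\<rbrakk> \<Longrightarrow> z \<sqsubseteq> x \<sqinter> y \<longleftrightarrow> z \<sqsubseteq> x \<and> z \<sqsubseteq> y"
  by (meson meet_closed meet_le meet_left meet_right le_trans)

lemma join_eqI:
  assumes "x \<in> carrier L" "y \<in> carrier L" "s \<in> carrier L"
    and s: "\<And>z. z \<in> carrier L \<Longrightarrow> s \<sqsubseteq> z \<longleftrightarrow> x \<sqsubseteq> z \<and> y \<sqsubseteq> z"
  shows "x \<squnion> y = s"
proof (rule le_antisym)
  show "x \<squnion> y \<sqsubseteq> s" using assms s[of s] by (simp add: join_le_iff)
  show "s \<sqsubseteq> x \<squnion> y" using assms s[of "x \<squnion> y"] by (simp add: join_left join_right)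
qed (use assms in simp_all)

lemma meet_eqI:
  assumes "x \<in> carrier L" "y \<in> carrier L" "s \<in> carrier L"
    and s: "\<And>z. z \<in> carrier L \<Longrightarrow> z \<sqsubseteq> s \<longleftrightarrow> z \<sqsubseteq> x \<and> z \<sqsubseteq> y"
  shows "x \<sqinter> y = s"
proof (rule le_antisym)
  show "s \<sqsubseteq> x \<sqinter> y" using assms s[of s] by (simp add: le_meet_iff)
  show "x \<sqinter> y \<sqsubseteq> s" using assms s[of "x \<sqinter> y"] by (simp add: meet_left meet_right)
qed (use assms in simp_all)

lemma join_absorb: "\<lbrakk>x \<sqsubseteq> y; x \<in> carrier L; y \<in> carrier L\<rbrakk> \<Longrightarrow> x \<squnion> y = y"
  by (rule join_eqI) (auto intro: le_trans[of x y])

lemma meet_absorb: "\<lbrakk>x \<sqsubseteq> y; x \<in> carrier L; y \<in> carrier L\<rbrakk> \<Longrightarrow> x \<sqinter> y = x"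
  by (rule meet_eqI) (auto intro: le_trans[of _ x y])

end

locale finite_length_lattice = lattice L + finite_length_order L for L :: "'a gorder" (structure)
begin

text \<open>This is the form of semimodularity that is convenient for case distinctions on covers: the
  element joined to both sides is arbitrary.\<close>

lemma semimodularI:
  assumes "\<And>x y z. covers L x y \<Longrightarrow> z \<in> carrier L \<Longrightarrow> covers_eq L (x \<squnion> z) (y \<squnion> z)"
  shows "semimodular L"
  unfolding semimodular_def
proof (intro ballI impI)
  fix a b assume ab: "a \<in> carrier L" "b \<in> carrier L" and c: "covers L (a \<sqinter> b) a"
  have "(a \<sqinter> b) \<squnion> b = b" by (rule join_absorb) (use ab meet_right in simp_all)
  then have "covers_eq L b (a \<squnion> b)" using assms[OF c ab(2)] by simp
  moreover have "b \<noteq> a \<squnion> b"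
  proof
    assume "b = a \<squnion> b"
    then have "a \<sqsubseteq> b" using ab join_left by metis
    then have "a \<sqinter> b = a" by (rule meet_absorb) (use ab in simp_all)
    then show False using c by (auto simp: covers_iff)
  qed
  ultimately show "covers L b (a \<squnion> b)" by (simp add: covers_eq_def)
qed

end

locale finite_length_semimodular = finite_length_lattice +
  assumes semimodular: "semimodular L"
begin

lemma covers_join_of_meet_eq:
  assumes "covers L u a" "u = a \<sqinter> b" "a \<in> carrier L" "b \<in> carrier L"
  shows "covers L b (a \<squnion> b)"
  using semimodular assms by (simp add: semimodular_def)

lemma covers_join_of_not_le:
  assumes c: "covers L u a" and b: "b \<in> carrier L" "u \<sqsubseteq> b" "\<not> a \<sqsubseteq> b"
  shows "covers L b (a \<squnion> b)"
proof (rule covers_join_of_meet_eq[OF c])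
  have a: "a \<in> carrier L" "u \<in> carrier L" "u \<sqsubseteq> a" using c by (auto simp: covers_iff)
  have "u \<sqsubseteq> a \<sqinter> b" using a b by (simp add: le_meet_iff)
  moreover have "a \<sqinter> b \<noteq> a" using b a meet_right by metis
  ultimately show "u = a \<sqinter> b" using c a b meet_left[of a b] by (auto simp: covers_iff)
qed (use assms in \<open>auto simp: covers_iff\<close>)

lemma covers_eq_join:
  assumes c: "covers L x y" and z: "z \<in> carrier L"
  shows "covers_eq L (x \<squnion> z) (y \<squnion> z)"
proof -
  have xy: "x \<in> carrier L" "y \<in> carrier L" "x \<sqsubseteq> y" using c by (auto simp: covers_iff)
  have eq: "y \<squnion> (x \<squnion> z) = y \<squnion> z"
    by (rule join_eqI) (use xy z in \<open>auto simp: join_le_iff intro: le_trans[of x y]\<close>)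
  show ?thesis
  proof (cases "y \<sqsubseteq> x \<squnion> z")
    case True
    have "y \<squnion> (x \<squnion> z) = x \<squnion> z"
      by (rule join_absorb) (use True xy z in simp_all)
    then show ?thesis using eq by (simp add: covers_eq_def)
  next
    case False
    then show ?thesis using covers_join_of_not_le[OF c _ _ False] xy z eq
      by (simp add: join_left covers_eq_def)
  qed
qed

text \<open>The Jordan-Hoelder property in the smallest case. An element \<open>w\<close> of the interval that is
  not above \<open>v\<close> meets \<open>v\<close> in \<open>u\<close>, so it is covered by \<open>v \<squnion> w = t\<close>; hence all proper elements
  of the interval are covered by \<open>t\<close>, and in particular no two of them are comparable.\<close>

lemma interval_of_length_two:
  assumes uv: "covers L u v" and vt: "covers L v t"
    and z: "z \<in> carrier L" "u \<sqsubseteq> z" "z \<noteq> u" "z \<sqsubseteq> t" "z \<noteq> t"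
  shows "covers L u z" and "covers L z t"
proof -
  have carr: "u \<in> carrier L" "v \<in> carrier L" "t \<in> carrier L" and le: "u \<sqsubseteq> v" "v \<sqsubseteq> t"
    using uv vt by (auto simp: covers_iff)
  have top: "covers L w t"
    if w: "w \<in> carrier L" "u \<sqsubseteq> w" "w \<noteq> u" "w \<sqsubseteq> t" "w \<noteq> t" for w
  proof (cases "v \<sqsubseteq> w")
    case True
    then have "w = v" using vt w by (auto simp: covers_iff)
    then show ?thesis using vt by simp
  next
    case False
    then have c: "covers L w (v \<squnion> w)" using covers_join_of_not_le[OF uv] w by simp
    have "\<not> w \<sqsubseteq> v" using False uv w by (auto simp: covers_iff)
    then have "v \<noteq> v \<squnion> w" using carr w join_right by metis
    moreover have "v \<squnion> w \<sqsubseteq> t" using carr w le by (simp add: join_le_iff)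
    ultimately have "v \<squnion> w = t" using vt w carr join_left[of v w] by (auto simp: covers_iff)
    then show ?thesis using c by simp
  qed
  show "covers L z t" using top z by blast
  show "covers L u z"
    unfolding covers_iff
  proof (intro conjI ballI impI)
    fix c assume c: "c \<in> carrier L" "u \<sqsubseteq> c" "c \<sqsubseteq> z"
    show "c = u \<or> c = z"
    proof (rule ccontr)
      assume n: "\<not> (c = u \<or> c = z)"
      have "c \<sqsubseteq> t" using c z carr le_trans by blast
      moreover have "c \<noteq> t" using c z carr by auto
      ultimately have "covers L c t" using top c n by blast
      then show False using c z n by (auto simp: covers_iff)
    qed
  qed (use z carr in auto)
qed

end

section \<open>The order on the enlarged set\<close>

locale lowering_construction = finite_length_semimodular L for L :: "'a gorder" (structure) +
  fixes e h :: 'a and up :: "'a \<Rightarrow> 'a"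
  assumes e_irreducible: "e \<in> join_irreducibles L"
    and h_carrier: "h \<in> carrier L"
    and h_less: "h \<sqsubset> lower_cover L e"
    and up_inj: "inj_on up (lowering_dom L e h)"
    and up_disjoint: "up ` lowering_dom L e h \<inter> carrier L = {}"
begin

abbreviation "e_star \<equiv> lower_cover L e"
abbreviation "D \<equiv> lowering_dom L e h"
abbreviation "K \<equiv> lowering L e h up"

lemma e_carrier [simp]: "e \<in> carrier L"
  using e_irreducible by (simp add: join_irreducibles_def)

lemma e_star_covers: "covers L e_star e"
  unfolding lower_cover_def
  by (rule theI') (use e_irreducible in \<open>simp add: join_irreducibles_def\<close>)

lemma e_star_unique: "covers L y e \<Longrightarrow> y = e_star"
  using e_irreducible e_star_covers by (auto simp: join_irreducibles_def)

lemma h_below: "h \<sqsubseteq> e_star" "h \<noteq> e_star"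
  using h_less by (auto simp: lless_eq)

lemma e_star_below: "e_star \<in> carrier L" "e_star \<sqsubseteq> e" "e_star \<noteq> e"
  using e_star_covers by (auto simp: covers_iff)

lemma h_below_e: "h \<sqsubseteq> e"
  by (rule le_trans[OF h_below(1) e_star_below(2)]) (simp_all add: h_carrier e_star_below)

lemma h_below_if: "\<lbrakk>e \<sqsubseteq> x; x \<in> carrier L\<rbrakk> \<Longrightarrow> h \<sqsubseteq> x"
  by (rule le_trans[OF h_below_e]) (simp_all add: h_carrier)

text \<open>If some cover of \<open>x\<close> is above \<open>e\<close>, it must be \<open>x \<squnion> e\<close>.\<close>

lemma D_iff:
  "x \<in> D \<longleftrightarrow> x \<in> carrier L \<and> h \<sqsubseteq> x \<and> \<not> e \<sqsubseteq> x \<and> \<not> covers L x (x \<squnion> e)"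
proof (cases "x \<in> carrier L \<and> h \<sqsubseteq> x \<and> \<not> e \<sqsubseteq> x")
  case True
  have "covers L x (x \<squnion> e)" if y: "covers L x y" "e \<sqsubseteq> y" for y
  proof -
    have carr: "x \<in> carrier L" "y \<in> carrier L" "x \<sqsubseteq> y" using y by (auto simp: covers_iff)
    have "x \<squnion> e \<noteq> x" using True carr join_right[of x e] by auto
    moreover have "x \<squnion> e \<sqsubseteq> y" using y carr by (simp add: join_le_iff)
    ultimately have "x \<squnion> e = y" using y carr join_left[of x e] by (auto simp: covers_iff)
    then show ?thesis using y by simp
  qed
  then show ?thesis
    using True join_right[of x e] by (auto simp: lowering_dom_def covers_eq_def)
qed (auto simp: lowering_dom_def covers_eq_def)

lemma D_carrier [simp]: "x \<in> D \<Longrightarrow> x \<in> carrier L"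
  and D_above_h: "x \<in> D \<Longrightarrow> h \<sqsubseteq> x"
  and D_not_above_e: "x \<in> D \<Longrightarrow> \<not> e \<sqsubseteq> x"
  by (simp_all add: D_iff)

text \<open>Joining \<open>x\<close> to a cover \<open>z \<prec> z \<squnion> e\<close> would give the forbidden cover \<open>x \<prec> x \<squnion> e\<close>.\<close>

lemma D_downward_closed:
  assumes x: "x \<in> D" and z: "z \<in> carrier L" "h \<sqsubseteq> z" "z \<sqsubseteq> x"
  shows "z \<in> D"
proof -
  have ex: "\<not> e \<sqsubseteq> x" and ncov: "\<not> covers L x (x \<squnion> e)" and xc: "x \<in> carrier L"
    using x by (auto simp: D_iff simp del: D_carrier)
  have "\<not> e \<sqsubseteq> z" using ex le_trans[of e z x] z xc by auto
  moreover have "\<not> covers L z (z \<squnion> e)"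
  proof
    assume c: "covers L z (z \<squnion> e)"
    have "\<not> z \<squnion> e \<sqsubseteq> x" using ex z xc by (simp add: join_le_iff)
    then have "covers L x ((z \<squnion> e) \<squnion> x)" using covers_join_of_not_le[OF c xc] z by simp
    moreover have "(z \<squnion> e) \<squnion> x = x \<squnion> e"
      by (rule join_eqI) (use z xc le_trans[of z x] in \<open>auto simp: join_le_iff\<close>)
    ultimately show False using ncov by simp
  qed
  ultimately show ?thesis using z by (simp add: D_iff del: D_carrier)
qed

lemma h_in_D: "h \<in> D"
proof -
  have "h \<squnion> e = e" by (rule join_absorb) (simp_all add: h_below_e h_carrier)
  moreover have "\<not> covers L h e" using e_star_unique h_below by blast
  moreover have "\<not> e \<sqsubseteq> h"
  proof
    assume "e \<sqsubseteq> h"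
    then have "e \<sqsubseteq> e_star" by (rule le_trans[OF _ h_below(1)]) (simp_all add: h_carrier e_star_below)
    then show False using e_star_below le_antisym[of e e_star] by simp
  qed
  ultimately show ?thesis using h_carrier by (simp add: D_iff del: D_carrier)
qed

lemma covers_eq_join_e:
  assumes "u \<in> carrier L" "h \<sqsubseteq> u" "u \<notin> D"
  shows "covers_eq L u (u \<squnion> e)"
proof (cases "e \<sqsubseteq> u")
  case True
  then have "u \<squnion> e = u" using assms join_absorb[of e u] join_comm[of L u e] by simp
  then show ?thesis by (simp add: covers_eq_def)
qed (use assms in \<open>simp add: D_iff covers_eq_def del: D_carrier\<close>)

lemma strictly_between_join_e:
  assumes "x \<in> D"
  obtains c where "c \<in> carrier L" "x \<sqsubseteq> c" "c \<noteq> x" "c \<sqsubseteq> x \<squnion> e" "c \<noteq> x \<squnion> e"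
proof -
  have x: "x \<in> carrier L" "\<not> e \<sqsubseteq> x" "\<not> covers L x (x \<squnion> e)" using assms by (auto simp: D_iff simp del: D_carrier)
  have "x \<noteq> x \<squnion> e" using x join_right[of x e] by auto
  then show thesis using x join_left[of x e] that by (auto simp: covers_iff)
qed

lemma up_notin_carrier [simp]: "x \<in> D \<Longrightarrow> up x \<notin> carrier L"
  using up_disjoint by blast

lemma up_eq_iff [simp]: "\<lbrakk>x \<in> D; y \<in> D\<rbrakk> \<Longrightarrow> up x = up y \<longleftrightarrow> x = y"
  using up_inj by (auto simp: inj_on_def)

lemma up_neq_old [simp]: "\<lbrakk>x \<in> D; y \<in> carrier L\<rbrakk> \<Longrightarrow> up x \<noteq> y" "\<lbrakk>x \<in> D; y \<in> carrier L\<rbrakk> \<Longrightarrow> y \<noteq> up x"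
  using up_notin_carrier by blast+

lemma carrier_K: "carrier K = carrier L \<union> up ` D"
  by (simp add: lowering_def Let_def)

lemma old_in_K [simp]: "x \<in> carrier L \<Longrightarrow> x \<in> carrier K"
  and up_in_K [simp]: "x \<in> D \<Longrightarrow> up x \<in> carrier K"
  by (simp_all add: carrier_K)

lemma K_cases:
  assumes "p \<in> carrier K"
  obtains (old) "p \<in> carrier L" | (new) x where "x \<in> D" "p = up x"
  using assms by (auto simp: carrier_K)

lemma eq_K: "eq K = (=)"
  by (simp add: lowering_def Let_def)

lemma le_K:
  "\<lbrakk>x \<in> carrier L; y \<in> carrier L\<rbrakk> \<Longrightarrow> x \<sqsubseteq>\<^bsub>K\<^esub> y \<longleftrightarrow> x \<sqsubseteq> y"
  "\<lbrakk>x \<in> D; y \<in> D\<rbrakk> \<Longrightarrow> up x \<sqsubseteq>\<^bsub>K\<^esub> up y \<longleftrightarrow> x \<sqsubseteq> y"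
  "\<lbrakk>x \<in> carrier L; y \<in> D\<rbrakk> \<Longrightarrow> x \<sqsubseteq>\<^bsub>K\<^esub> up y \<longleftrightarrow> x \<sqsubseteq> y"
  "\<lbrakk>x \<in> D; y \<in> carrier L\<rbrakk> \<Longrightarrow> up x \<sqsubseteq>\<^bsub>K\<^esub> y \<longleftrightarrow> x \<squnion> e \<sqsubseteq> y"
proof -
  have old: "x \<notin> up ` D" if "x \<in> carrier L" for x using that up_disjoint by blast
  have inv: "inv_into D up (up x) = x" if "x \<in> D" for x using that up_inj by simp
  show "\<lbrakk>x \<in> carrier L; y \<in> carrier L\<rbrakk> \<Longrightarrow> x \<sqsubseteq>\<^bsub>K\<^esub> y \<longleftrightarrow> x \<sqsubseteq> y"
    "\<lbrakk>x \<in> D; y \<in> D\<rbrakk> \<Longrightarrow> up x \<sqsubseteq>\<^bsub>K\<^esub> up y \<longleftrightarrow> x \<sqsubseteq> y"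
    "\<lbrakk>x \<in> carrier L; y \<in> D\<rbrakk> \<Longrightarrow> x \<sqsubseteq>\<^bsub>K\<^esub> up y \<longleftrightarrow> x \<sqsubseteq> y"
    "\<lbrakk>x \<in> D; y \<in> carrier L\<rbrakk> \<Longrightarrow> up x \<sqsubseteq>\<^bsub>K\<^esub> y \<longleftrightarrow> x \<squnion> e \<sqsubseteq> y"
    using old inv by (simp_all add: lowering_def Let_def)
qed

lemma partial_order_K: "partial_order K"
proof
  fix p q r
  show "p \<sqsubseteq>\<^bsub>K\<^esub> p" if "p \<in> carrier K"
    using that by (cases rule: K_cases) (auto simp: le_K)
  show "p .=\<^bsub>K\<^esub> q" if pq: "p \<sqsubseteq>\<^bsub>K\<^esub> q" "q \<sqsubseteq>\<^bsub>K\<^esub> p" "p \<in> carrier K" "q \<in> carrier K"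
  proof -
    have False if "x \<in> carrier L" "y \<in> D" "x \<sqsubseteq> y" "y \<squnion> e \<sqsubseteq> x" for x y
      using that D_not_above_e[of y] le_trans[of e x y] by (simp add: join_le_iff)
    then have "p = q" using pq(3,4,1,2)
      by (elim K_cases) (auto simp: le_K intro: le_antisym)
    then show ?thesis by (simp add: eq_K)
  qed
  show "p \<sqsubseteq>\<^bsub>K\<^esub> r" if pqr: "p \<sqsubseteq>\<^bsub>K\<^esub> q" "q \<sqsubseteq>\<^bsub>K\<^esub> r" "p \<in> carrier K" "q \<in> carrier K" "r \<in> carrier K"
  proof -
    have False if "y \<in> carrier L" "z \<in> D" "e \<sqsubseteq> y" "y \<sqsubseteq> z" for y z
      using that D_not_above_e[of z] le_trans[of e y z] by simp
    then show ?thesis using pqr(3,4,5,1,2)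
      by (elim K_cases) (auto simp: le_K join_le_iff intro: le_trans)
  qed
qed (auto simp: eq_K)

section \<open>The length is unchanged\<close>

text \<open>Outside the trivial case that \<open>C\<close> has no new elements, \<open>C'\<close> consists of the old part \<open>A\<close>
  of \<open>C\<close>, the elements \<open>B\<close> underlying its new part, and one extra element \<open>c\<close>. Only the least
  element of \<open>B\<close> can also belong to \<open>A\<close>, so the extra element restores the cardinality.\<close>

lemma order_chain_in_K_bounded:
  assumes C: "order_chain K C" and fin: "finite C"
  obtains C' where "order_chain L C'" "finite C'" "card C \<le> card C'"
proof (cases "C \<subseteq> carrier L")
  case True
  then have "order_chain L C" using C by (auto simp: order_chain_def le_K subset_iff)
  then show thesis using that fin by blast
next
  case False
  define A where "A = C \<inter> carrier L"
  define B where "B = {x \<in> D. up x \<in> C}"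
  have CK: "C \<subseteq> carrier K" and tot: "\<And>p q. p \<in> C \<Longrightarrow> q \<in> C \<Longrightarrow> p \<sqsubseteq>\<^bsub>K\<^esub> q \<or> q \<sqsubseteq>\<^bsub>K\<^esub> p"
    using C by (auto simp: order_chain_def)
  have C_eq: "C = A \<union> up ` B" using CK by (auto simp: A_def B_def carrier_K)
  have AL: "A \<subseteq> carrier L" and BD: "B \<subseteq> D" by (auto simp: A_def B_def)
  have finA: "finite A" using fin by (simp add: A_def)
  have "up ` B \<subseteq> C" by (auto simp: B_def)
  then have "finite (up ` B)" using fin by (rule finite_subset)
  then have finB: "finite B" using BD up_inj finite_image_iff inj_on_subset by blast
  have "B \<noteq> {}" using False C_eq AL by auto
  moreover have BB: "x \<sqsubseteq> y \<or> y \<sqsubseteq> x" if "x \<in> B" "y \<in> B" for x y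
    using tot[of "up x" "up y"] that by (auto simp: B_def le_K)
  ultimately have "order_chain L B" unfolding order_chain_def using BD by auto
  then obtain b where b: "b \<in> B" "\<And>x. x \<in> B \<Longrightarrow> x \<sqsubseteq> b"
    by (rule order_chain_has_greatest) blast
  have bD: "b \<in> D" using b BD by blast
  obtain c where c: "c \<in> carrier L" "b \<sqsubseteq> c" "c \<noteq> b" "c \<sqsubseteq> b \<squnion> e" "c \<noteq> b \<squnion> e"
    using bD by (rule strictly_between_join_e)
  \<comment> \<open>No old element lies between two new ones, so \<open>x\<close> is below or above all of them.\<close>
  have A_cases: "(\<forall>y\<in>B. x \<sqsubseteq> y) \<or> b \<squnion> e \<sqsubseteq> x" if x: "x \<in> A" for x
  proof (rule disjCI)
    assume nb: "\<not> b \<squnion> e \<sqsubseteq> x"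
    have xC: "x \<in> C" "x \<in> carrier L" using x by (auto simp: A_def)
    have "x \<sqsubseteq> b" using tot[of x "up b"] xC b nb bD by (auto simp: B_def le_K)
    have "\<not> e \<sqsubseteq> x" using \<open>x \<sqsubseteq> b\<close> D_not_above_e[OF bD] le_trans[of e x b] xC bD by auto
    have "x \<sqsubseteq> y" if y: "y \<in> B" for y
    proof -
      have "y \<in> D" "up y \<in> C" using y by (simp_all add: B_def)
      then show ?thesis using tot[of x "up y"] xC \<open>\<not> e \<sqsubseteq> x\<close> by (auto simp: le_K join_le_iff)
    qed
    then show "\<forall>y\<in>B. x \<sqsubseteq> y" by blast
  qed
  let ?C = "insert c (A \<union> B)"
  have carr: "?C \<subseteq> carrier L" using c AL BD by auto
  have bL: "b \<in> carrier L" "b \<squnion> e \<in> carrier L" using bD by simp_all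
  have Ac: "x \<sqsubseteq> c \<or> c \<sqsubseteq> x" if "x \<in> A" for x
    using A_cases[OF that] b(1) c bL that AL le_trans[of x b c] le_trans[of c "b \<squnion> e" x] by blast
  have Bc: "x \<sqsubseteq> c" if "x \<in> B" for x
    using b(2)[OF that] c bL that BD le_trans[of x b c] by auto
  have AB: "x \<sqsubseteq> y \<or> y \<sqsubseteq> x" if "x \<in> A" "y \<in> B" for x y
  proof (cases "b \<squnion> e \<sqsubseteq> x")
    case True
    have "y \<sqsubseteq> b \<squnion> e" using le_trans[OF b(2)[OF that(2)] join_left[of b e]] bL that BD by auto
    moreover have "y \<in> carrier L" "x \<in> carrier L" using that BD AL by auto
    ultimately show ?thesis using le_trans[of y "b \<squnion> e" x] True bL by blast
  qed (use A_cases that in blast)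
  have AA: "x \<sqsubseteq> y \<or> y \<sqsubseteq> x" if "x \<in> A" "y \<in> A" for x y
    using tot[of x y] that by (auto simp: A_def le_K)
  have "x \<sqsubseteq> y \<or> y \<sqsubseteq> x" if "x \<in> ?C" "y \<in> ?C" for x y
  proof -
    have "x = c \<or> x \<in> A \<or> x \<in> B" "y = c \<or> y \<in> A \<or> y \<in> B" using that by simp_all
    then show ?thesis
      using AA[of x y] BB[of x y] AB[of x y] AB[of y x] Ac[of x] Ac[of y] Bc[of x] Bc[of y]
        le_refl[OF c(1)] by metis
  qed
  then have chain: "order_chain L ?C"
    unfolding order_chain_def using carr by simp
  have "c \<notin> B" using b(2)[of c] le_antisym[of c b] c bL by auto
  moreover have "c \<notin> A"
  proof
    assume "c \<in> A"
    then have "c \<sqsubseteq> b \<or> b \<squnion> e \<sqsubseteq> c" using A_cases b(1) by blast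
    then show False using le_antisym[of c b] le_antisym[of c "b \<squnion> e"] c bL by auto
  qed
  ultimately have card_C: "card ?C = Suc (card (A \<union> B))" using finA finB by simp
  have "x = y" if "x \<in> A \<inter> B" "y \<in> A \<inter> B" for x y
  proof -
    have least: "\<forall>z\<in>B. x \<sqsubseteq> z" if "x \<in> A \<inter> B" for x
    proof -
      have "x \<in> D" using that BD by auto
      then have "\<not> b \<squnion> e \<sqsubseteq> x" using D_not_above_e[of x] bL by (simp add: join_le_iff)
      then show ?thesis using A_cases that by blast
    qed
    have "x \<sqsubseteq> y" "y \<sqsubseteq> x" using least that by simp_all
    moreover have "x \<in> carrier L" "y \<in> carrier L" using that AL by auto
    ultimately show ?thesis by (rule le_antisym)
  qed
  then have "card (A \<inter> B) \<le> 1"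
    using finA by (simp add: card_le_Suc0_iff_eq)
  moreover have "card C = card A + card B"
  proof -
    have "A \<inter> up ` B = {}" using AL BD up_disjoint by blast
    then have "card C = card A + card (up ` B)"
      unfolding C_eq using finA finB by (simp add: card_Un_disjoint)
    then show ?thesis using BD up_inj card_image inj_on_subset by metis
  qed
  ultimately have "card C \<le> card ?C"
    using card_Un_Int[OF finA finB] card_C by simp
  then show thesis using that chain finA finB by blast
qed

text \<open>An infinite chain of \<open>K\<close> would contain finite chains that are too long for \<open>L\<close>.\<close>

lemma order_length_K: "order_length K = order_length L"
proof (rule antisym)
  obtain m where m: "order_length L = enat m"
    using finite_length by (cases "order_length L") auto
  have bound: "card C \<le> Suc m" if C: "order_chain K C" "finite C" for C
  proof -
    obtain C' where C': "order_chain L C'" "finite C'" "card C \<le> card C'"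
      using C by (rule order_chain_in_K_bounded)
    have "chain_length C' \<le> enat m"
      unfolding m[symmetric] order_length_def by (rule SUP_upper) (simp add: C')
    then show ?thesis using C' by (simp add: chain_length_def)
  qed
  have "chain_length C \<le> enat m" if C: "order_chain K C" for C
  proof -
    have "finite C"
    proof (rule ccontr)
      assume "infinite C"
      then obtain F where F: "finite F" "card F = Suc (Suc m)" "F \<subseteq> C"
        using infinite_arbitrarily_large by blast
      then have "order_chain K F" using C unfolding order_chain_def by auto
      then show False using bound[of F] F by simp
    qed
    then show ?thesis using bound[OF C] by (simp add: chain_length_def)
  qed
  then show "order_length K \<le> order_length L"
    unfolding m order_length_def[of K] by (intro SUP_least) simp
  have "order_chain K C" if "order_chain L C" for C
    using that by (auto simp: order_chain_def le_K subset_iff)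
  then show "order_length L \<le> order_length K"
    unfolding order_length_def by (intro SUP_subset_mono) auto
qed

sublocale K: finite_length_order K
proof -
  interpret partial_order K by (rule partial_order_K)
  show "finite_length_order K"
    by unfold_locales (use finite_length order_length_K in simp)
qed

section \<open>Joins, meets and covers\<close>

text \<open>For \<open>u \<ge> h\<close> this is the join of \<open>u\<close> with the new element \<open>up h\<close> in \<open>K\<close>, but it is defined
  before \<open>K\<close> is known to be a lattice. The characterisation \<open>adjoin_le\<close> of its upper bounds is the
  same in both cases of the definition.\<close>

definition adjoin :: "'a \<Rightarrow> 'a" where
  "adjoin u = (if u \<in> D then up u else u \<squnion> e)"

lemma adjoin_in_K [simp]: "u \<in> carrier L \<Longrightarrow> adjoin u \<in> carrier K"
  by (simp add: adjoin_def)

lemma adjoin_le: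
  assumes u: "u \<in> carrier L" "h \<sqsubseteq> u"
  shows "y \<in> carrier L \<Longrightarrow> adjoin u \<sqsubseteq>\<^bsub>K\<^esub> y \<longleftrightarrow> u \<squnion> e \<sqsubseteq> y"
    and "y \<in> D \<Longrightarrow> adjoin u \<sqsubseteq>\<^bsub>K\<^esub> up y \<longleftrightarrow> u \<sqsubseteq> y"
  using u D_downward_closed[of y u] D_not_above_e[of y]
  by (auto simp: adjoin_def le_K join_le_iff)

lemma lub_old_old:
  assumes "x \<in> carrier L" "y \<in> carrier L" "r \<in> carrier K"
  shows "x \<squnion> y \<sqsubseteq>\<^bsub>K\<^esub> r \<longleftrightarrow> x \<sqsubseteq>\<^bsub>K\<^esub> r \<and> y \<sqsubseteq>\<^bsub>K\<^esub> r"
  using assms(3,1,2) by (cases rule: K_cases) (auto simp: le_K join_le_iff)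

lemma above_h_join: "\<lbrakk>x \<in> carrier L; y \<in> D\<rbrakk> \<Longrightarrow> h \<sqsubseteq> x \<squnion> y"
  using le_trans[OF D_above_h[of y] join_right[of x y]] h_carrier by simp

lemma lub_old_new:
  assumes "x \<in> carrier L" "y \<in> D" "r \<in> carrier K"
  shows "adjoin (x \<squnion> y) \<sqsubseteq>\<^bsub>K\<^esub> r \<longleftrightarrow> x \<sqsubseteq>\<^bsub>K\<^esub> r \<and> up y \<sqsubseteq>\<^bsub>K\<^esub> r"
  using assms(3,1,2) above_h_join[of x y]
  by (cases rule: K_cases) (auto simp: le_K join_le_iff adjoin_le)

lemma lub_new_new:
  assumes "x \<in> D" "y \<in> D" "r \<in> carrier K"
  shows "adjoin (x \<squnion> y) \<sqsubseteq>\<^bsub>K\<^esub> r \<longleftrightarrow> up x \<sqsubseteq>\<^bsub>K\<^esub> r \<and> up y \<sqsubseteq>\<^bsub>K\<^esub> r"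
  using assms(3,1,2) above_h_join[of x y]
  by (cases rule: K_cases) (auto simp: le_K join_le_iff adjoin_le)

lemma glb_old_old:
  assumes "x \<in> carrier L" "y \<in> carrier L" "r \<in> carrier K"
  shows "r \<sqsubseteq>\<^bsub>K\<^esub> x \<sqinter> y \<longleftrightarrow> r \<sqsubseteq>\<^bsub>K\<^esub> x \<and> r \<sqsubseteq>\<^bsub>K\<^esub> y"
  using assms(3,1,2) by (cases rule: K_cases) (auto simp: le_K le_meet_iff)

lemma meet_in_D:
  "\<lbrakk>x \<in> carrier L; h \<sqsubseteq> x; y \<in> D\<rbrakk> \<Longrightarrow> x \<sqinter> y \<in> D"
  using D_downward_closed[of y "x \<sqinter> y"] D_above_h[of y] meet_right[of x y] h_carrier
  by (simp add: le_meet_iff)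

text \<open>A new element below \<open>x\<close> is one whose underlying element joined with \<open>e\<close> is below \<open>x\<close>. So there are new
  common lower bounds only if \<open>e \<le> x\<close>; then \<open>h \<le> x\<close> as well, and \<open>x \<sqinter> y\<close> is in \<open>D\<close>.\<close>

lemma glb_old_new:
  assumes "x \<in> carrier L" "y \<in> D" "r \<in> carrier K"
  shows "r \<sqsubseteq>\<^bsub>K\<^esub> (if e \<sqsubseteq> x then up (x \<sqinter> y) else x \<sqinter> y) \<longleftrightarrow> r \<sqsubseteq>\<^bsub>K\<^esub> x \<and> r \<sqsubseteq>\<^bsub>K\<^esub> up y"
  using assms(3,1,2) meet_in_D[of x y] h_below_if[of x] D_not_above_e[of y]
  by (cases rule: K_cases) (auto simp: le_K le_meet_iff join_le_iff)

lemma glb_new_new: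
  assumes "x \<in> D" "y \<in> D" "r \<in> carrier K"
  shows "r \<sqsubseteq>\<^bsub>K\<^esub> up (x \<sqinter> y) \<longleftrightarrow> r \<sqsubseteq>\<^bsub>K\<^esub> up x \<and> r \<sqsubseteq>\<^bsub>K\<^esub> up y"
  using assms(3,1,2) meet_in_D[of x y] D_above_h[of x]
  by (cases rule: K_cases) (auto simp: le_K le_meet_iff)

lemma lattice_K: "lattice K"
proof
  fix p q assume p: "p \<in> carrier K" and q: "q \<in> carrier K"
  show "\<exists>s. least K s (Upper K {p, q})"
  proof -
    have "\<exists>s\<in>carrier K. \<forall>r\<in>carrier K. s \<sqsubseteq>\<^bsub>K\<^esub> r \<longleftrightarrow> p \<sqsubseteq>\<^bsub>K\<^esub> r \<and> q \<sqsubseteq>\<^bsub>K\<^esub> r"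
      using p
    proof (cases rule: K_cases)
      case old
      note p_old = this
      from q show ?thesis
      proof (cases rule: K_cases)
        case old
        then show ?thesis using p_old lub_old_old[of p q] by (intro bexI[of _ "p \<squnion> q"]) auto
      next
        case (new y)
        then show ?thesis using p_old lub_old_new[of p y]
          by (intro bexI[of _ "adjoin (p \<squnion> y)"]) auto
      qed
    next
      case (new x)
      note p_new = this
      from q show ?thesis
      proof (cases rule: K_cases)
        case old
        then show ?thesis using p_new lub_old_new[of q x]
          by (intro bexI[of _ "adjoin (q \<squnion> x)"]) auto
      next
        case (new y)
        then show ?thesis using p_new lub_new_new[of x y]
          by (intro bexI[of _ "adjoin (x \<squnion> y)"]) auto
      qed
    qed
    then obtain s where "s \<in> carrier K"
      "\<And>r. r \<in> carrier K \<Longrightarrow> s \<sqsubseteq>\<^bsub>K\<^esub> r \<longleftrightarrow> p \<sqsubseteq>\<^bsub>K\<^esub> r \<and> q \<sqsubseteq>\<^bsub>K\<^esub> r"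
      by blast
    then have "least K s (Upper K {p, q})"
      using p q by (auto simp: least_def Upper_def)
    then show ?thesis ..
  qed
  show "\<exists>s. greatest K s (Lower K {p, q})"
  proof -
    have "\<exists>s\<in>carrier K. \<forall>r\<in>carrier K. r \<sqsubseteq>\<^bsub>K\<^esub> s \<longleftrightarrow> r \<sqsubseteq>\<^bsub>K\<^esub> p \<and> r \<sqsubseteq>\<^bsub>K\<^esub> q"
      using p
    proof (cases rule: K_cases)
      case old
      note p_old = this
      from q show ?thesis
      proof (cases rule: K_cases)
        case old
        then show ?thesis using p_old glb_old_old[of p q] by (intro bexI[of _ "p \<sqinter> q"]) auto
      next
        case (new y)
        then show ?thesis using p_old glb_old_new[of p y] meet_in_D[of p y] h_below_if[of p]
          by (intro bexI[of _ "if e \<sqsubseteq> p then up (p \<sqinter> y) else p \<sqinter> y"]) auto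
      qed
    next
      case (new x)
      note p_new = this
      from q show ?thesis
      proof (cases rule: K_cases)
        case old
        then show ?thesis using p_new glb_old_new[of q x] meet_in_D[of q x] h_below_if[of q]
          by (intro bexI[of _ "if e \<sqsubseteq> q then up (q \<sqinter> x) else q \<sqinter> x"]) auto
      next
        case (new y)
        then show ?thesis using p_new glb_new_new[of x y] meet_in_D[of x y] D_above_h[of x]
          by (intro bexI[of _ "up (x \<sqinter> y)"]) auto
      qed
    qed
    then obtain s where "s \<in> carrier K"
      "\<And>r. r \<in> carrier K \<Longrightarrow> r \<sqsubseteq>\<^bsub>K\<^esub> s \<longleftrightarrow> r \<sqsubseteq>\<^bsub>K\<^esub> p \<and> r \<sqsubseteq>\<^bsub>K\<^esub> q"
      by blast
    then have "greatest K s (Lower K {p, q})"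
      using p q by (auto simp: greatest_def Lower_def)
    then show ?thesis ..
  qed
qed

sublocale K: finite_length_lattice K
  using lattice_K K.finite_length_order_axioms by (rule finite_length_lattice.intro)

lemma join_K:
  "\<lbrakk>x \<in> carrier L; y \<in> carrier L\<rbrakk> \<Longrightarrow> x \<squnion>\<^bsub>K\<^esub> y = x \<squnion> y"
  "\<lbrakk>x \<in> carrier L; y \<in> D\<rbrakk> \<Longrightarrow> x \<squnion>\<^bsub>K\<^esub> up y = adjoin (x \<squnion> y)"
  "\<lbrakk>x \<in> D; y \<in> carrier L\<rbrakk> \<Longrightarrow> up x \<squnion>\<^bsub>K\<^esub> y = adjoin (x \<squnion> y)"
  "\<lbrakk>x \<in> D; y \<in> D\<rbrakk> \<Longrightarrow> up x \<squnion>\<^bsub>K\<^esub> up y = adjoin (x \<squnion> y)"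
proof -
  show "\<lbrakk>x \<in> carrier L; y \<in> carrier L\<rbrakk> \<Longrightarrow> x \<squnion>\<^bsub>K\<^esub> y = x \<squnion> y"
    by (rule K.join_eqI) (simp_all add: lub_old_old)
  show 1: "\<lbrakk>x \<in> carrier L; y \<in> D\<rbrakk> \<Longrightarrow> x \<squnion>\<^bsub>K\<^esub> up y = adjoin (x \<squnion> y)" for x y
    by (rule K.join_eqI) (simp_all add: lub_old_new)
  show "\<lbrakk>x \<in> D; y \<in> carrier L\<rbrakk> \<Longrightarrow> up x \<squnion>\<^bsub>K\<^esub> y = adjoin (x \<squnion> y)"
    using 1[of y x] join_comm[of L x y] join_comm[of K "up x" y] by simp
  show "\<lbrakk>x \<in> D; y \<in> D\<rbrakk> \<Longrightarrow> up x \<squnion>\<^bsub>K\<^esub> up y = adjoin (x \<squnion> y)"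
    by (rule K.join_eqI) (simp_all add: lub_new_new)
qed

lemma sublattice_K: "sublattice L K"
proof -
  have "x \<sqinter>\<^bsub>K\<^esub> y = x \<sqinter> y" if "x \<in> carrier L" "y \<in> carrier L" for x y
    by (rule K.meet_eqI) (use that in \<open>simp_all add: glb_old_old\<close>)
  moreover have "carrier L \<noteq> {}" using e_carrier by blast
  ultimately show ?thesis by (auto simp: sublattice_def le_K join_K)
qed

text \<open>A new element between \<open>x\<close> and \<open>y\<close> sits in an interval from \<open>w\<close> to \<open>w \<squnion> e\<close> that already
  contains a further element of \<open>L\<close>; so a cover of \<open>L\<close> stays a cover.\<close>

lemma covers_K_old_old:
  assumes x: "x \<in> carrier L" and y: "y \<in> carrier L"
  shows "covers K x y \<longleftrightarrow> covers L x y"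
proof
  assume "covers K x y"
  then show "covers L x y" using x y by (auto simp: covers_iff K.covers_iff le_K)
next
  assume c: "covers L x y"
  have "r = x \<or> r = y" if r: "r \<in> carrier K" "x \<sqsubseteq>\<^bsub>K\<^esub> r" "r \<sqsubseteq>\<^bsub>K\<^esub> y" for r
    using r(1)
  proof (cases rule: K_cases)
    case old
    then show ?thesis using r c x y by (auto simp: covers_iff le_K)
  next
    case (new w)
    have w: "w \<in> carrier L" "w \<squnion> e \<in> carrier L" using new by simp_all
    have xw: "x \<sqsubseteq> w" "w \<squnion> e \<sqsubseteq> y" using r new x y by (auto simp: le_K)
    obtain d where d: "d \<in> carrier L" "w \<sqsubseteq> d" "d \<noteq> w" "d \<sqsubseteq> w \<squnion> e" "d \<noteq> w \<squnion> e"
      using new(1) by (rule strictly_between_join_e)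
    have "x \<sqsubseteq> d" "d \<sqsubseteq> y"
      using le_trans[OF xw(1) d(2)] le_trans[OF d(4) xw(2)] w d x y by auto
    then have "d = x \<or> d = y" using c d by (auto simp: covers_iff)
    then show ?thesis using d xw w le_antisym by blast
  qed
  then show "covers K x y" using c x y by (auto simp: covers_iff K.covers_iff le_K)
qed

lemma covers_K_old_new:
  assumes x: "x \<in> carrier L" and y: "y \<in> D"
  shows "covers K x (up y) \<longleftrightarrow> x = y"
proof
  assume c: "covers K x (up y)"
  have "x \<sqsubseteq> y" using c x y by (simp add: K.covers_iff le_K)
  moreover have "y = x \<or> y = up y"
    using K.covers_between[OF c, of y] x y calculation by (auto simp: le_K)
  ultimately show "x = y" using y by auto
next
  assume "x = y"
  moreover have "r = y \<or> r = up y" if r: "r \<in> carrier K" "y \<sqsubseteq>\<^bsub>K\<^esub> r" "r \<sqsubseteq>\<^bsub>K\<^esub> up y" for r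
    using r y by (elim K_cases) (auto simp: le_K intro: le_antisym)
  ultimately show "covers K x (up y)" using y by (auto simp: K.covers_iff le_K)
qed

lemma covers_K_new_new:
  assumes x: "x \<in> D" and y: "y \<in> D"
  shows "covers K (up x) (up y) \<longleftrightarrow> covers L x y"
proof
  assume c: "covers K (up x) (up y)"
  have le: "x \<sqsubseteq> y" "x \<noteq> y" using c x y by (auto simp: K.covers_iff le_K)
  have "z = x \<or> z = y" if z: "z \<in> carrier L" "x \<sqsubseteq> z" "z \<sqsubseteq> y" for z
  proof -
    have "h \<sqsubseteq> z" using le_trans[OF D_above_h[OF x] z(2)] z x h_carrier by simp
    then have "z \<in> D" using D_downward_closed[OF y] z by simp
    moreover then have "up z = up x \<or> up z = up y"
      using K.covers_between[OF c, of "up z"] x y z by (simp add: le_K)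
    ultimately show ?thesis using x y by simp
  qed
  then show "covers L x y" using le x y by (simp add: covers_iff)
next
  assume c: "covers L x y"
  have "r = up x \<or> r = up y"
    if r: "r \<in> carrier K" "up x \<sqsubseteq>\<^bsub>K\<^esub> r" "r \<sqsubseteq>\<^bsub>K\<^esub> up y" for r
    using r(1)
  proof (cases rule: K_cases)
    case old
    then have "x \<squnion> e \<sqsubseteq> r" "r \<sqsubseteq> y" using r x y by (auto simp: le_K)
    then have "e \<sqsubseteq> y" using le_trans[of e r y] old x y by (simp add: join_le_iff)
    then show ?thesis using D_not_above_e[OF y] by simp
  next
    case (new w)
    then show ?thesis using r c x y by (auto simp: covers_iff le_K)
  qed
  then show "covers K (up x) (up y)" using c x y by (auto simp: covers_iff K.covers_iff le_K)
qed

lemma covers_K_new_old: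
  assumes x: "x \<in> D" and y: "y \<in> carrier L"
  shows "covers K (up x) y \<longleftrightarrow> y = x \<squnion> e \<and> (\<forall>z\<in>D. x \<sqsubseteq> z \<longrightarrow> z \<sqsubseteq> y \<longrightarrow> z = x)"
proof
  assume c: "covers K (up x) y"
  have le: "x \<squnion> e \<sqsubseteq> y" using c x y by (simp add: K.covers_iff le_K)
  then have "x \<squnion> e = up x \<or> x \<squnion> e = y"
    using K.covers_between[OF c, of "x \<squnion> e"] x y by (simp add: le_K)
  then have y_eq: "y = x \<squnion> e" using x up_neq_old(1)[of x "x \<squnion> e"] by auto
  have ey: "e \<sqsubseteq> y" using le x y by (simp add: join_le_iff)
  have "z = x" if z: "z \<in> D" "x \<sqsubseteq> z" "z \<sqsubseteq> y" for z
  proof -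
    have "up z = up x \<or> up z = y"
      using K.covers_between[OF c, of "up z"] x y z ey by (simp add: le_K join_le_iff)
    then show ?thesis using z x y by simp
  qed
  then show "y = x \<squnion> e \<and> (\<forall>z\<in>D. x \<sqsubseteq> z \<longrightarrow> z \<sqsubseteq> y \<longrightarrow> z = x)" using y_eq by blast
next
  assume a: "y = x \<squnion> e \<and> (\<forall>z\<in>D. x \<sqsubseteq> z \<longrightarrow> z \<sqsubseteq> y \<longrightarrow> z = x)"
  have "r = up x \<or> r = y" if r: "r \<in> carrier K" "up x \<sqsubseteq>\<^bsub>K\<^esub> r" "r \<sqsubseteq>\<^bsub>K\<^esub> y" for r
    using r(1)
  proof (cases rule: K_cases)
    case old
    then show ?thesis using r a x y le_antisym[of r y] by (auto simp: le_K)
  next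
    case (new w)
    then show ?thesis using r a x y by (auto simp: le_K join_le_iff)
  qed
  then show "covers K (up x) y" using a x y by (auto simp: K.covers_iff le_K)
qed

section \<open>Semimodularity\<close>

lemma covers_eq_adjoin:
  assumes "u \<in> carrier L" "h \<sqsubseteq> u"
  shows "covers_eq K u (adjoin u)"
proof (cases "u \<in> D")
  case True
  then show ?thesis by (simp add: adjoin_def covers_eq_def covers_K_old_new)
next
  case False
  then show ?thesis using covers_eq_join_e[of u] assms
    by (auto simp: adjoin_def covers_eq_def covers_K_old_old)
qed

lemma neq_join_e: "x \<in> D \<Longrightarrow> x \<noteq> x \<squnion> e"
  using D_not_above_e[of x] join_right[of x e] by auto

text \<open>In an interval of length two, an element \<open>z\<close> strictly between \<open>u\<close> and \<open>u \<squnion> e\<close> is covered by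
  \<open>u \<squnion> e = z \<squnion> e\<close> and therefore not in \<open>D\<close>.\<close>

lemma up_covers_join_e:
  assumes u: "u \<in> D" and uv: "covers L u v" and vt: "covers L v (u \<squnion> e)"
  shows "covers K (up u) (u \<squnion> e)"
proof -
  have t: "u \<squnion> e \<in> carrier L" using u by simp
  have "z = u" if z: "z \<in> D" "u \<sqsubseteq> z" "z \<sqsubseteq> u \<squnion> e" for z
  proof (rule ccontr)
    assume n: "z \<noteq> u"
    have "z \<noteq> u \<squnion> e" using z D_not_above_e[of z] u join_right[of u e] by auto
    then have "covers L z (u \<squnion> e)"
      using interval_of_length_two(2)[OF uv vt _ z(2) n z(3)] z by simp
    moreover have "z \<squnion> e = u \<squnion> e"
    proof (rule le_antisym)
      show "z \<squnion> e \<sqsubseteq> u \<squnion> e" using z u by (simp add: join_le_iff join_right)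
      show "u \<squnion> e \<sqsubseteq> z \<squnion> e"
        using z u le_trans[OF z(2) join_left[of z e]] by (simp add: join_le_iff join_right)
    qed (use z u in simp_all)
    ultimately show False using z(1) by (simp add: D_iff del: D_carrier)
  qed
  then show ?thesis using covers_K_new_old[OF u t] by blast
qed

text \<open>The critical case is that \<open>u \<prec> v\<close> leaves \<open>D\<close>. Then \<open>u \<prec> v \<prec> v \<squnion> e\<close>, and \<open>u \<squnion> e\<close> lies in
  this interval of length two. As \<open>u \<squnion> e\<close> does not cover \<open>u\<close>, it is the top \<open>v \<squnion> e\<close>, so
  that \<open>up u\<close> is covered by \<open>v \<squnion> e\<close>.\<close>

lemma adjoin_covers_eq:
  assumes c: "covers_eq L u v" and u: "u \<in> carrier L" "h \<sqsubseteq> u"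
  shows "covers_eq K (adjoin u) (adjoin v)"
proof (cases "u = v")
  case True
  then show ?thesis by (simp add: covers_eq_def)
next
  case False
  then have uv: "covers L u v" using c by (simp add: covers_eq_def)
  then have v: "v \<in> carrier L" "u \<sqsubseteq> v" by (auto simp: covers_iff)
  have hv: "h \<sqsubseteq> v" using le_trans[OF u(2) v(2)] u v h_carrier by simp
  consider "v \<in> D" | "u \<in> D" "v \<notin> D" | "u \<notin> D" "v \<notin> D" by blast
  then show ?thesis
  proof cases
    case 1
    then have "u \<in> D" using D_downward_closed u v by blast
    then show ?thesis using 1 uv by (simp add: adjoin_def covers_eq_def covers_K_new_new)
  next
    case 2
    let ?t = "v \<squnion> e"
    have t: "?t \<in> carrier L" "u \<squnion> e \<in> carrier L" using u v by simp_all
    have nev: "\<not> e \<sqsubseteq> v" using 2(1) uv v(1) unfolding lowering_dom_def covers_eq_def by blast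
    then have vt: "covers L v ?t"
      using covers_eq_join_e[of v] v hv 2 join_right[of v e] by (auto simp: covers_eq_def)
    have le: "u \<sqsubseteq> u \<squnion> e" "u \<squnion> e \<sqsubseteq> ?t"
      using u v le_trans[OF v(2) join_left[of v e]] by (simp_all add: join_left join_right join_le_iff)
    have t_eq: "u \<squnion> e = ?t"
    proof (rule ccontr)
      assume "u \<squnion> e \<noteq> ?t"
      then have "covers L u (u \<squnion> e)"
        using interval_of_length_two(1)[OF uv vt t(2)] le neq_join_e[OF 2(1)] by auto
      then show False using 2(1) by (simp add: D_iff del: D_carrier)
    qed
    then have "covers K (up u) (u \<squnion> e)"
      using up_covers_join_e[OF 2(1) uv] vt by simp
    then show ?thesis using 2 t_eq by (simp add: adjoin_def covers_eq_def)
  next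
    case 3
    have "covers_eq L (u \<squnion> e) (v \<squnion> e)" using covers_eq_join[OF uv] by simp
    then show ?thesis using 3 u v by (auto simp: adjoin_def covers_eq_def covers_K_old_old)
  qed
qed

text \<open>That \<open>up x\<close> is covered by \<open>x \<squnion> e\<close> means that every \<open>w\<close> strictly between \<open>x\<close> and \<open>x \<squnion> e\<close> is
  outside \<open>D\<close> and thus covered by \<open>w \<squnion> e = x \<squnion> e\<close>. Hence this interval has length two, and joining
  its maximal chain with \<open>s\<close> bounds the length of the interval from \<open>s\<close> to \<open>s \<squnion> e\<close>.\<close>

lemma adjoin_covers_eq_join_e:
  assumes x: "x \<in> D" and cov: "covers K (up x) (x \<squnion> e)"
    and s: "s \<in> carrier L" "x \<sqsubseteq> s"
  shows "covers_eq K (adjoin s) (s \<squnion> e)"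
proof (cases "s \<in> D")
  case False
  then show ?thesis by (simp add: adjoin_def covers_eq_def)
next
  case True
  let ?t = "x \<squnion> e"
  have t: "?t \<in> carrier L" and xc: "x \<in> carrier L" using x by simp_all
  have coatom: "covers L w ?t"
    if w: "w \<in> carrier L" "x \<sqsubseteq> w" "w \<noteq> x" "w \<sqsubseteq> ?t" "w \<noteq> ?t" for w
  proof -
    have "w \<notin> D" using cov covers_K_new_old[OF x t] w by blast
    moreover have "h \<sqsubseteq> w" using le_trans[OF D_above_h[OF x] w(2)] h_carrier xc w by simp
    ultimately have "covers_eq L w (w \<squnion> e)" using covers_eq_join_e w by blast
    moreover have "w \<squnion> e = ?t"
    proof (rule le_antisym)
      show "w \<squnion> e \<sqsubseteq> ?t" using w xc by (simp add: join_le_iff join_right)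
      show "?t \<sqsubseteq> w \<squnion> e"
        using w xc le_trans[OF w(2) join_left[of w e]] by (simp add: join_le_iff join_right)
    qed (use w xc in simp_all)
    ultimately show ?thesis using w by (simp add: covers_eq_def)
  qed
  \<comment> \<open>Any \<open>c\<close> will do, because elements strictly between \<open>x\<close> and \<open>?t\<close> are pairwise incomparable.\<close>
  obtain c where c: "c \<in> carrier L" "x \<sqsubseteq> c" "c \<noteq> x" "c \<sqsubseteq> ?t" "c \<noteq> ?t"
    using x by (rule strictly_between_join_e)
  have ct: "covers L c ?t" using coatom c by blast
  have xcov: "covers L x c"
  proof -
    have "d = x \<or> d = c" if d: "d \<in> carrier L" "x \<sqsubseteq> d" "d \<sqsubseteq> c" for d
    proof (rule ccontr)
      assume n: "\<not> (d = x \<or> d = c)"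
      have "d \<sqsubseteq> ?t" using le_trans[OF d(3) c(4)] d c t by simp
      moreover have "d \<noteq> ?t" using d c t le_antisym[of c ?t] by auto
      ultimately have "covers L d ?t" using coatom d n by blast
      then show False using covers_between[of d ?t c] c d n by auto
    qed
    then show ?thesis using c xc by (simp add: covers_iff)
  qed
  have "x \<squnion> s = s" using join_absorb[OF s(2)] xc s by simp
  moreover have "?t \<squnion> s = s \<squnion> e"
    by (rule join_eqI)
      (use s xc le_trans[OF s(2)] in \<open>auto simp: join_le_iff\<close>)
  ultimately have "covers_eq L s (c \<squnion> s)" "covers_eq L (c \<squnion> s) (s \<squnion> e)"
    using covers_eq_join[OF xcov s(1)] covers_eq_join[OF ct s(1)] by simp_all
  moreover have "\<not> covers L s (s \<squnion> e)" using True by (simp add: D_iff del: D_carrier)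
  ultimately have "covers L s (c \<squnion> s)" "covers L (c \<squnion> s) (s \<squnion> e)"
    using neq_join_e[OF True] by (auto simp: covers_eq_def)
  then show ?thesis using up_covers_join_e[OF True] True
    by (simp add: adjoin_def covers_eq_def)
qed

lemma semimodular_K: "semimodular K"
proof (rule K.semimodularI)
  fix p q r assume c: "covers K p q" and r: "r \<in> carrier K"
  have pq: "p \<in> carrier K" "q \<in> carrier K" using c by (auto simp: K.covers_iff)
  \<comment> \<open>In each case \<open>p \<squnion> r\<close> and \<open>q \<squnion> r\<close> are joins in \<open>L\<close> or values of \<open>adjoin\<close> at such joins.\<close>
  from pq(1) pq(2) show "covers_eq K (p \<squnion>\<^bsub>K\<^esub> r) (q \<squnion>\<^bsub>K\<^esub> r)"
  proof (cases rule: K_cases[case_product K_cases])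
    case old_old
    then have cL: "covers L p q" using c covers_K_old_old by simp
    from r show ?thesis
    proof (cases rule: K_cases)
      case old
      then show ?thesis using covers_eq_join[OF cL old] old_old
        by (auto simp: join_K covers_eq_def covers_K_old_old)
    next
      case (new w)
      then show ?thesis
        using adjoin_covers_eq[OF covers_eq_join[OF cL, of w]] old_old above_h_join[of p w]
        by (simp add: join_K)
    qed
  next
    case (old_new y)
    then have p: "p = y" using c covers_K_old_new by simp
    from r show ?thesis
    proof (cases rule: K_cases)
      case old
      then show ?thesis
        using covers_eq_adjoin[of "y \<squnion> r"] old_new p above_h_join[of r y] join_comm[of L r y]
        by (simp add: join_K)
    next
      case (new w)
      then show ?thesis using old_new p by (simp add: join_K covers_eq_def)
    qed
  next
    case (new_old x)
    then have cx: "covers K (up x) q" using c by simp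
    then have q: "q = x \<squnion> e" using covers_K_new_old new_old by blast
    have join_q: "q \<squnion> z = (x \<squnion> z) \<squnion> e" if "z \<in> carrier L" for z
      by (rule join_eqI) (use that new_old q in \<open>auto simp: join_le_iff\<close>)
    have step: "covers_eq K (adjoin (x \<squnion> z)) (q \<squnion> z)" if "z \<in> carrier L" for z
      using adjoin_covers_eq_join_e[of x "x \<squnion> z"] new_old cx q join_q[OF that] that
      by (simp add: join_left)
    from r show ?thesis
    proof (cases rule: K_cases)
      case old
      then show ?thesis using step[of r] new_old by (simp add: join_K)
    next
      case (new w)
      have "e \<sqsubseteq> q \<squnion> w"
        using join_q[of w] new new_old join_right[of "x \<squnion> w" e] by simp
      then have "adjoin (q \<squnion> w) = q \<squnion> w"
        using D_not_above_e[of "q \<squnion> w"] join_absorb[of e "q \<squnion> w"] join_comm[of L e "q \<squnion> w"]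
          new new_old by (auto simp: adjoin_def)
      then show ?thesis using step[of w] new new_old by (simp add: join_K)
    qed
  next
    case (new_new x y)
    then have cL: "covers L x y" using c covers_K_new_new by simp
    have above: "h \<sqsubseteq> x \<squnion> z" if "z \<in> carrier L" for z
      using that new_new above_h_join[of z x] join_comm[of L z x] by simp
    have step: "covers_eq K (adjoin (x \<squnion> z)) (adjoin (y \<squnion> z))" if "z \<in> carrier L" for z
      using adjoin_covers_eq[OF covers_eq_join[OF cL that]] that new_new above by simp
    from r show ?thesis
      using step new_new by (cases rule: K_cases) (auto simp: join_K)
  qed
qed

section \<open>Join-irreducible elements\<close>

text \<open>Old elements keep their old lower covers. Besides these, \<open>x\<close> may get lower covers \<open>up z\<close> with
  \<open>x = z \<squnion> e\<close>. For join-irreducible \<open>x \<noteq> e\<close> this is impossible, as \<open>z\<close> and \<open>e\<close> would both be below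
  the old lower cover; for \<open>x = e\<close> the element \<open>up h\<close> forces such a cover.\<close>

lemma old_irreducible_iff:
  assumes x: "x \<in> carrier L"
  shows "x \<in> join_irreducibles K \<longleftrightarrow> x \<in> join_irreducibles L \<and> x \<noteq> e"
proof
  assume "x \<in> join_irreducibles K"
  then have "\<exists>!y. covers K y x" by (simp add: join_irreducibles_def)
  then obtain y where y: "covers K y x" and unique: "\<And>y'. covers K y' x \<Longrightarrow> y' = y"
    by metis
  have "x \<noteq> e"
  proof
    assume xe: "x = e"
    have "y = e_star"
      using unique[of e_star] e_star_covers xe covers_K_old_old e_star_below by simp
    have "up h \<sqsubseteq>\<^bsub>K\<^esub> e" using h_in_D h_below_e by (simp add: le_K join_le_iff h_carrier)
    then obtain c where c: "up h \<sqsubseteq>\<^bsub>K\<^esub> c" "covers K c e"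
      using K.lower_cover_above[of "up h" e] h_in_D by auto
    then have "up h \<sqsubseteq>\<^bsub>K\<^esub> e_star" using unique \<open>y = e_star\<close> xe by auto
    then have "e \<sqsubseteq> e_star" using h_in_D e_star_below h_carrier by (simp add: le_K join_le_iff)
    then show False using e_star_below le_antisym[of e e_star] by simp
  qed
  moreover have "\<exists>!c. covers L c x"
  proof -
    have "y \<in> carrier K" using y by (simp add: K.covers_iff)
    then show ?thesis
    proof (cases rule: K_cases)
      case old
      then have "covers L y x" using y covers_K_old_old x by simp
      moreover have "c = y" if "covers L c x" for c
      proof -
        have "c \<in> carrier L" using that by (simp add: covers_iff)
        then show ?thesis using unique covers_K_old_old that x by simp
      qed
      ultimately show ?thesis by blast
    next
      case (new z)
      then have "x = z \<squnion> e" using y covers_K_new_old[of z x] x by simp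
      then have "e \<sqsubseteq> x" using new join_right[of z e] by simp
      then obtain c where c: "covers L c x" using lower_cover_above[of e x] x \<open>x \<noteq> e\<close> by auto
      then have "c \<in> carrier L" by (simp add: covers_iff)
      then have "c = up z" using unique[of c] c covers_K_old_old x new by simp
      then show ?thesis using \<open>c \<in> carrier L\<close> new by auto
    qed
  qed
  ultimately show "x \<in> join_irreducibles L \<and> x \<noteq> e" using x by (simp add: join_irreducibles_def)
next
  assume a: "x \<in> join_irreducibles L \<and> x \<noteq> e"
  then have "\<exists>!c. covers L c x" by (simp add: join_irreducibles_def)
  then obtain c where c: "covers L c x" and unique: "\<And>c'. covers L c' x \<Longrightarrow> c' = c"
    by metis
  have cL: "c \<in> carrier L" "c \<sqsubseteq> x" "c \<noteq> x" using c by (auto simp: covers_iff)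
  have below_c: "z \<sqsubseteq> c" if z: "z \<in> carrier L" "z \<sqsubseteq> x" "z \<noteq> x" for z
    using lower_cover_above[OF z(1) x z(2,3)] unique by metis
  have "y = c" if y: "covers K y x" for y
  proof -
    have "y \<in> carrier K" using y by (simp add: K.covers_iff)
    then show ?thesis
    proof (cases rule: K_cases)
      case old
      then show ?thesis using y unique covers_K_old_old x by simp
    next
      case (new z)
      then have xz: "x = z \<squnion> e" using y covers_K_new_old[of z x] x by simp
      have "z \<sqsubseteq> c" using below_c[of z] xz new neq_join_e[of z] join_left[of z e] by simp
      moreover have "e \<sqsubseteq> c" using below_c[of e] xz new a join_right[of z e] by auto
      ultimately have "x \<sqsubseteq> c" using xz new cL by (simp add: join_le_iff)
      then show ?thesis using cL x le_antisym[of x c] by simp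
    qed
  qed
  moreover have "covers K c x" using c covers_K_old_old x cL by simp
  ultimately show "x \<in> join_irreducibles K" using x by (auto simp: join_irreducibles_def)
qed

lemma new_lower_cover_h:
  assumes y: "covers K y (up h)"
  shows "y = h"
proof -
  have "y \<in> carrier K" using y by (simp add: K.covers_iff)
  then show ?thesis
  proof (cases rule: K_cases)
    case old
    then show ?thesis using y covers_K_old_new h_in_D by simp
  next
    case (new z)
    then have "covers L z h" using y covers_K_new_new h_in_D by simp
    then show ?thesis using D_above_h[of z] new le_antisym[of z h] by (auto simp: covers_iff)
  qed
qed

text \<open>If \<open>h < x\<close>, then \<open>x\<close> has a lower cover \<open>c \<ge> h\<close>, and \<open>up x\<close> covers both \<open>x\<close> and \<open>up c\<close>.\<close>

lemma new_irreducible_iff: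
  assumes x: "x \<in> D"
  shows "up x \<in> join_irreducibles K \<longleftrightarrow> x = h"
proof
  assume "up x \<in> join_irreducibles K"
  then have "\<exists>!y. covers K y (up x)" by (simp add: join_irreducibles_def)
  then obtain y where unique: "\<And>y'. covers K y' (up x) \<Longrightarrow> y' = y"
    by metis
  have y: "y = x" using unique[of x] covers_K_old_new[of x x] x by simp
  show "x = h"
  proof (rule ccontr)
    assume "x \<noteq> h"
    then obtain c where c: "h \<sqsubseteq> c" "covers L c x"
      using lower_cover_above[of h x] D_above_h[OF x] h_carrier x by auto
    have cL: "c \<in> carrier L" "c \<sqsubseteq> x" using c by (auto simp: covers_iff)
    have "c \<in> D" using D_downward_closed[OF x cL(1) c(1) cL(2)] .
    then have "up c = y" using unique[of "up c"] covers_K_new_new[of c x] c x by simp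
    then show False using y \<open>c \<in> D\<close> x by simp
  qed
next
  assume xh: "x = h"
  have "covers K h (up h)" using covers_K_old_new h_carrier h_in_D by simp
  moreover have "y = h" if "covers K y (up h)" for y
    using that new_lower_cover_h by blast
  ultimately show "up x \<in> join_irreducibles K"
    using xh h_in_D by (auto simp: join_irreducibles_def)
qed

lemma lowers_to_cover_K: "lowers_to_cover K L e h"
proof -
  have up_h: "up h \<in> join_irreducibles K" using new_irreducible_iff h_in_D by simp
  have "join_irreducibles L \<subseteq> carrier L" by (auto simp: join_irreducibles_def)
  then have "join_irreducibles L - join_irreducibles K = {e}"
    using old_irreducible_iff e_irreducible by blast
  moreover have new: "join_irreducibles K - join_irreducibles L = {up h}"
  proof -
    have "p = up h" if p: "p \<in> join_irreducibles K" "p \<notin> join_irreducibles L" for p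
    proof -
      have "p \<in> carrier K" using p by (simp add: join_irreducibles_def)
      then show ?thesis
        by (cases rule: K_cases) (use p old_irreducible_iff new_irreducible_iff in auto)
    qed
    moreover have "up h \<notin> join_irreducibles L"
      using h_in_D by (simp add: join_irreducibles_def)
    ultimately show ?thesis using up_h by blast
  qed
  moreover have "lower_cover K (up h) = h"
    unfolding lower_cover_def
    by (rule the_equality) (use covers_K_old_new h_carrier h_in_D new_lower_cover_h in auto)
  moreover have "semimodular_lattice_fin_length K"
    using lattice_K semimodular_K K.finite_length
    by (simp add: semimodular_lattice_fin_length_def)
  ultimately show ?thesis
    using sublattice_K order_length_K h_carrier h_less up_h
    by (auto simp: lowers_to_cover_def)
qed

end

theorem theorem5p4:
  fixes L :: "'a gorder" and e h :: 'a and up :: "'a \<Rightarrow> 'a" and N :: "'a set"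
  assumes "semimodular_lattice_fin_length L"
    and "e \<in> join_irreducibles L"
    and "\<not> atom L e"
    and "h \<in> carrier L"
    and "h \<sqsubset>\<^bsub>L\<^esub> lower_cover L e"
    and "bij_betw up (lowering_dom L e h) N"
    and "N \<inter> carrier L = {}"
  shows "lowers_to_cover (lowering L e h up) L e h"
proof -
  interpret lattice L using assms(1) by (simp add: semimodular_lattice_fin_length_def)
  interpret lowering_construction L e h up
    by unfold_locales
      (use assms in \<open>auto simp: semimodular_lattice_fin_length_def bij_betw_def\<close>)
  show ?thesis by (rule lowers_to_cover_K)
qed

end
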